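(* Let $u<v$ be real numbers and let $f\colon[u,v]_{\mathbb{Q}}\to\mathbb{R}$ be a function such that its derivative $f'$ is defined on all of $[u,v]_{\mathbb{Q}}$, is uniform and is uniformly continuous on $[u,v]_{\mathbb{Q}}$. Then there exists a real number $x$ with $u<x<v$ and $$\frac{f(v)-f(u)}{v-u}=f'(x),$$ where $f(u),f(v),f'(x)$ are extended values.
   Context: For reals $u\le v$, $[u,v]_{\mathbb{Q}}=\{a\in\mathbb{Q}\mid u\le a\le v\}$. For $M\subset\mathbb{Q}$, $g\colon M\to\mathbb{R}$ is uniformly continuous (UC) if for every $k\in\mathbb{N}$ there is $l\in\mathbb{N}$ with $a,b\in M$, $|a-b|\le 1/l\Rightarrow |g(a)-g(b)|\le 1/k$. If $g$ is UC and the real $x$ is a limit of elements of $M$, then $\lim g(a_n)$ exists for every sequence $(a_n)$ in $M$ converging to $x$ and is independent of the sequence; it is denoted $g(x)$ (extended value). (Under the hypotheses $f$ is UC, so $f(u),f(v)$ are defined.) For $f\colon M\to\mathbb{R}$ and $a\in M$ a limit point of $M$, $f'(a)=y$ if for every $k$ there is $l$ with $b\in M$, $0<|a-b|\le 1/l\Rightarrow|\frac{f(b)-f(a)}{b-a}-y|\le1/k$. The derivative is uniform on a set $N$ of points where it exists if for every $k$ there is $l$ such that for all $a\in N$, $b\in M$ with $0<|a-b|\le 1/l$: $|\frac{f(b)-f(a)}{b-a}-f'(a)|\le 1/k$. *)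

theory Defs
  imports "HOL-Analysis.Analysis"
begin

definition rat_interval :: "real \<Rightarrow> real \<Rightarrow> real set" where
  "rat_interval u v = {a \<in> \<rat>. u \<le> a \<and> a \<le> v}"

text \<open>Only the values of \<^term>\<open>g\<close> on \<^term>\<open>M\<close> matter, also when \<^term>\<open>x \<in> M\<close>. The description
  is proper when \<^term>\<open>g\<close> is uniformly continuous on \<^term>\<open>M\<close> and \<^term>\<open>x \<in> closure M\<close>.\<close>

definition extended_value :: "real set \<Rightarrow> (real \<Rightarrow> real) \<Rightarrow> real \<Rightarrow> real" where
  "extended_value M g x =
    (THE y. \<forall>s. (\<forall>n. s n \<in> M) \<and> s \<longlonglongrightarrow> x \<longrightarrow> (\<lambda>n. g (s n)) \<longlonglongrightarrow> y)"

definition uniform_derivative_on ::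
    "real set \<Rightarrow> real set \<Rightarrow> (real \<Rightarrow> real) \<Rightarrow> (real \<Rightarrow> real) \<Rightarrow> bool" where
  "uniform_derivative_on N M f f' \<longleftrightarrow>
    (\<forall>k::nat. k > 0 \<longrightarrow> (\<exists>l::nat. l > 0 \<and>
      (\<forall>a\<in>N. \<forall>b\<in>M. 0 < \<bar>a - b\<bar> \<and> \<bar>a - b\<bar> \<le> 1 / real l \<longrightarrow>
        \<bar>(f b - f a) / (b - a) - f' a\<bar> \<le> 1 / real k)))"

lemma extended_value_eqI:
  assumes "x \<in> closure M"
    and "\<And>s. (\<And>n. s n \<in> M) \<Longrightarrow> s \<longlonglongrightarrow> x \<Longrightarrow> (\<lambda>n. g (s n)) \<longlonglongrightarrow> y"
  shows "extended_value M g x = y"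
  unfolding extended_value_def
proof (rule the_equality)
  show "\<forall>s. (\<forall>n. s n \<in> M) \<and> s \<longlonglongrightarrow> x \<longrightarrow> (\<lambda>n. g (s n)) \<longlonglongrightarrow> y"
    using assms(2) by blast
next
  fix z
  assume z: "\<forall>s. (\<forall>n. s n \<in> M) \<and> s \<longlonglongrightarrow> x \<longrightarrow> (\<lambda>n. g (s n)) \<longlonglongrightarrow> z"
  obtain s where "\<And>n. s n \<in> M" "s \<longlonglongrightarrow> x"
    using assms(1) unfolding closure_sequential by blast
  then show "z = y"
    using z assms(2) LIMSEQ_unique by blast
qed

lemma extended_value_tendsto:
  assumes "uniformly_continuous_on M g" "x \<in> closure M" "\<And>n. s n \<in> M" "s \<longlonglongrightarrow> x"
  shows "(\<lambda>n. g (s n)) \<longlonglongrightarrow> extended_value M g x"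
proof -
  obtain h where h: "uniformly_continuous_on (closure M) h" "\<And>a. a \<in> M \<Longrightarrow> g a = h a"
    using uniformly_continuous_on_extension_on_closure[OF assms(1)] by metis
  have lim: "(\<lambda>n. g (t n)) \<longlonglongrightarrow> h x" if t: "\<And>n. t n \<in> M" "t \<longlonglongrightarrow> x" for t
  proof -
    have "\<forall>\<^sub>F n in sequentially. t n \<in> closure M"
      using t(1) closure_subset by (intro always_eventually) blast
    then have "(\<lambda>n. h (t n)) \<longlonglongrightarrow> h x"
      by (rule continuous_on_tendsto_compose
          [OF uniformly_continuous_imp_continuous[OF h(1)] t(2) assms(2)])
    then show ?thesis
      using h(2) t(1) by simp
  qed
  then show ?thesis
    using extended_value_eqI[OF assms(2) lim] assms(3,4) by simp
qed

end

theory Submission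
  imports Defs
begin

text \<open>
  Multiplying the uniform difference-quotient estimate by \<open>b - a\<close> gives
  \<open>\<bar>f b - f a - f' a (b - a)\<bar> \<le> \<epsilon> \<bar>b - a\<bar>\<close> for all close points \<open>a, b\<close> of the rational interval.
  As \<open>f'\<close> is bounded, \<open>f\<close> is uniformly continuous, and the estimate passes to limits of \<open>a\<close> and \<open>b\<close>.
  Hence the extension of \<open>f\<close> to the real interval is differentiable with derivative the
  extension of \<open>f'\<close>, and the classical mean value theorem applies.
\<close>

text \<open>The form without division also covers \<open>a = b\<close>, where both sides vanish. It
  can therefore be applied termwise to two sequences that may meet, and both sides depend
  continuously on the points and values.\<close>

lemma uniform_derivative_onD:
  assumes "uniform_derivative_on N M f f'" "e > 0"
  obtains d where "d > 0"
    "\<And>a b. \<lbrakk>a \<in> N; b \<in> M; \<bar>b - a\<bar> < d\<rbrakk> \<Longrightarrow> \<bar>f b - f a - f' a * (b - a)\<bar> \<le> e * \<bar>b - a\<bar>"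
proof -
  obtain k :: nat where k: "k > 0" "1 / real k < e"
    using nat_approx_posE[OF \<open>e > 0\<close>] by (metis zero_less_Suc)
  obtain l :: nat where l: "l > 0"
    "\<And>a b. \<lbrakk>a \<in> N; b \<in> M; 0 < \<bar>a - b\<bar>; \<bar>a - b\<bar> \<le> 1 / real l\<rbrakk>
      \<Longrightarrow> \<bar>(f b - f a) / (b - a) - f' a\<bar> \<le> 1 / real k"
    using assms(1)[unfolded uniform_derivative_on_def, rule_format, OF k(1)] by auto
  show thesis
  proof (rule that)
    show "1 / real l > 0"
      using l(1) by simp
    fix a b
    assume ab: "a \<in> N" "b \<in> M" "\<bar>b - a\<bar> < 1 / real l"
    show "\<bar>f b - f a - f' a * (b - a)\<bar> \<le> e * \<bar>b - a\<bar>"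
    proof (cases "a = b")
      case False
      have "f b - f a - f' a * (b - a) = ((f b - f a) / (b - a) - f' a) * (b - a)"
        using False by (simp add: field_simps)
      moreover have "\<bar>(f b - f a) / (b - a) - f' a\<bar> \<le> e"
        using l(2)[of a b] ab False k(2) by (simp add: abs_minus_commute)
      ultimately show ?thesis
        by (simp add: abs_mult mult_right_mono)
    qed simp
  qed
qed

text \<open>The estimate with error factor 1 and a bound \<open>B\<close> for the derivative make
  \<open>f\<close> Lipschitz with constant \<open>B + 1\<close> on pairs of points closer than
  \<open>d\<close>.\<close>

lemma uniform_derivative_on_imp_uniformly_continuous_on:
  assumes der: "uniform_derivative_on M M f f'" and bdd: "bounded (f' ` M)"
  shows "uniformly_continuous_on M f"
proof -
  obtain B where B: "B > 0" "\<And>a. a \<in> M \<Longrightarrow> \<bar>f' a\<bar> \<le> B"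
    using bdd unfolding bounded_pos by auto
  obtain d where d: "d > 0"
    "\<And>a b. \<lbrakk>a \<in> M; b \<in> M; \<bar>b - a\<bar> < d\<rbrakk> \<Longrightarrow> \<bar>f b - f a - f' a * (b - a)\<bar> \<le> 1 * \<bar>b - a\<bar>"
    using uniform_derivative_onD[OF der zero_less_one] by blast
  have lip: "\<bar>f b - f a\<bar> \<le> (B + 1) * \<bar>b - a\<bar>" if "a \<in> M" "b \<in> M" "\<bar>b - a\<bar> < d" for a b
  proof -
    have "\<bar>f' a * (b - a)\<bar> \<le> B * \<bar>b - a\<bar>"
      using B(2)[OF that(1)] by (simp add: abs_mult mult_right_mono)
    then show ?thesis
      using d(2)[OF that] by (simp add: algebra_simps)
  qed
  show ?thesis
    unfolding uniformly_continuous_on_def dist_real_def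
  proof (intro allI impI)
    fix e :: real
    assume "e > 0"
    show "\<exists>d>0. \<forall>x\<in>M. \<forall>x'\<in>M. \<bar>x' - x\<bar> < d \<longrightarrow> \<bar>f x' - f x\<bar> < e"
    \<comment> \<open>The bound \<open>d\<close> makes the local Lipschitz estimate available;
      \<open>e / (B + 1)\<close> brings its right-hand side below \<open>e\<close>.\<close>
    proof (intro exI[of _ "min d (e / (B + 1))"] conjI ballI impI)
      show "0 < min d (e / (B + 1))"
        using d(1) B(1) \<open>e > 0\<close> by simp
      fix a b
      assume ab: "a \<in> M" "b \<in> M" "\<bar>b - a\<bar> < min d (e / (B + 1))"
      then have "(B + 1) * \<bar>b - a\<bar> < e"
        using B(1) by (simp add: field_simps)
      then show "\<bar>f b - f a\<bar> < e"
        using lip[of a b] ab by simp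
    qed
  qed
qed

text \<open>Because \<open>d\<close> does not depend on the base point, one \<open>d\<close> serves
  all pairs approximating \<open>x\<close> and \<open>y\<close>, so the estimate survives when both
  points move to the closure.\<close>

lemma has_real_derivative_extended_value:
  assumes der: "uniform_derivative_on M M f f'"
    and ucf: "uniformly_continuous_on M f" and ucf': "uniformly_continuous_on M f'"
    and x: "x \<in> closure M"
  shows "(extended_value M f has_real_derivative extended_value M f' x) (at x within closure M)"
  unfolding has_field_derivative_def has_derivative_within_alt
proof (intro conjI allI impI)
  let ?F = "extended_value M f" and ?G = "extended_value M f'"
  show "bounded_linear ((*) (?G x))"
    by (rule bounded_linear_mult_right)
  fix e :: real
  assume "e > 0"
  obtain d where d: "d > 0"
    "\<And>a b. \<lbrakk>a \<in> M; b \<in> M; \<bar>b - a\<bar> < d\<rbrakk> \<Longrightarrow> \<bar>f b - f a - f' a * (b - a)\<bar> \<le> e * \<bar>b - a\<bar>"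
    using uniform_derivative_onD[OF der \<open>e > 0\<close>] by blast
  have "\<bar>?F y - ?F x - ?G x * (y - x)\<bar> \<le> e * \<bar>y - x\<bar>"
    if y: "y \<in> closure M" "\<bar>y - x\<bar> < d" for y
  proof -
    obtain s where s: "\<And>n. s n \<in> M" "s \<longlonglongrightarrow> x"
      using x unfolding closure_sequential by blast
    obtain t where t: "\<And>n. t n \<in> M" "t \<longlonglongrightarrow> y"
      using y(1) unfolding closure_sequential by blast
    have "(\<lambda>n. \<bar>t n - s n\<bar>) \<longlonglongrightarrow> \<bar>y - x\<bar>"
      by (intro tendsto_intros s t)
    \<comment> \<open>The strict bound on the limit passes back to almost all approximating pairs;
      the non-strict estimate for these then passes forward to the limit.\<close>
    then have "\<forall>\<^sub>F n in sequentially. \<bar>t n - s n\<bar> < d"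
      using y(2) by (rule order_tendstoD)
    then have ev: "\<forall>\<^sub>F n in sequentially.
        \<bar>f (t n) - f (s n) - f' (s n) * (t n - s n)\<bar> \<le> e * \<bar>t n - s n\<bar>"
      by eventually_elim (intro d(2) s t)
    have lims: "(\<lambda>n. f (t n)) \<longlonglongrightarrow> ?F y" "(\<lambda>n. f (s n)) \<longlonglongrightarrow> ?F x"
        "(\<lambda>n. f' (s n)) \<longlonglongrightarrow> ?G x"
      using extended_value_tendsto[OF ucf y(1) t] extended_value_tendsto[OF ucf x s]
        extended_value_tendsto[OF ucf' x s] by simp_all
    have lim_lhs: "(\<lambda>n. \<bar>f (t n) - f (s n) - f' (s n) * (t n - s n)\<bar>)
        \<longlonglongrightarrow> \<bar>?F y - ?F x - ?G x * (y - x)\<bar>"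
      by (intro tendsto_intros lims s t)
    have lim_rhs: "(\<lambda>n. e * \<bar>t n - s n\<bar>) \<longlonglongrightarrow> e * \<bar>y - x\<bar>"
      by (intro tendsto_intros s t)
    show ?thesis
      by (rule tendsto_le[OF sequentially_bot lim_rhs lim_lhs ev])
  qed
  then show "\<exists>d>0. \<forall>y\<in>closure M. norm (y - x) < d \<longrightarrow>
      norm (?F y - ?F x - ?G x * (y - x)) \<le> e * norm (y - x)"
    using d(1) by auto
qed

text \<open>Density of the rationals reaches every interior point. The endpoints, possibly
  irrational, are limits of interior points since \<open>u < v\<close>.\<close>

lemma closure_rat_interval:
  assumes "u < v"
  shows "closure (rat_interval u v) = {u..v}"
proof
  show "closure (rat_interval u v) \<subseteq> {u..v}"
    by (rule closure_minimal) (auto simp: rat_interval_def)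
  have "{u<..<v} \<subseteq> closure ({u<..<v} \<inter> \<rat>)"
    using open_Int_closure_subset[of "{u<..<v}" \<rat>] by (simp add: Rats_closure_real)
  also have "\<dots> \<subseteq> closure (rat_interval u v)"
    by (intro closure_mono) (auto simp: rat_interval_def)
  finally show "{u..v} \<subseteq> closure (rat_interval u v)"
    using closure_minimal[OF _ closed_closure] assms
    by (metis closure_greaterThanLessThan)
qed

theorem theorem2p46:
  fixes u v :: real and f f' :: "real \<Rightarrow> real"
  assumes "u < v"
    and "\<And>a. a \<in> rat_interval u v \<Longrightarrow>
           (f has_real_derivative f' a) (at a within rat_interval u v)"
    and "uniform_derivative_on (rat_interval u v) (rat_interval u v) f f'"
    and "uniformly_continuous_on (rat_interval u v) f'"
  shows "\<exists>x. u < x \<and> x < v \<and>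
    (extended_value (rat_interval u v) f v - extended_value (rat_interval u v) f u) / (v - u)
      = extended_value (rat_interval u v) f' x"
proof -
  let ?M = "rat_interval u v"
  \<comment> \<open>A uniformly continuous function maps bounded sets to bounded sets, so this
    bounds \<open>f'\<close>, as the uniform continuity of \<open>f\<close> requires.\<close>
  have "bounded ?M"
    by (rule bounded_subset[of "{u..v}"]) (auto simp: rat_interval_def)
  then have "uniformly_continuous_on ?M f"
    using assms(3,4) bounded_uniformly_continuous_image
      uniform_derivative_on_imp_uniformly_continuous_on by blast
  then have "(extended_value ?M f has_real_derivative extended_value ?M f' x) (at x within {u..v})"
    if "x \<in> {u..v}" for x
    using has_real_derivative_extended_value[of ?M f f' x] assms that
    by (simp add: closure_rat_interval)
  \<comment> \<open>The extension of \<open>f\<close> is differentiable on all of the real interval,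
    one-sidedly at the endpoints, so the classical theorem gives an interior point.\<close>
  then obtain x where "x \<in> {u<..<v}"
    "extended_value ?M f v - extended_value ?M f u = extended_value ?M f' x * (v - u)"
    using mvt_simple[OF assms(1), of "extended_value ?M f" "\<lambda>x. (*) (extended_value ?M f' x)"]
    unfolding has_field_derivative_def by auto
  then show ?thesis
    using assms(1) by (intro exI[of _ x]) auto
qed

end
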